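(* Let $n \ge 1$. For a set $V = \{w_0,\dots,w_n\} \subset \mathbf{C}^n$ of $n+1$ distinct unit vectors, let $\mathrm{D}(V) = \min\{|\det(w_{j_1},\dots,w_{j_n})| : 0 \le j_1 < \dots < j_n \le n\}$. Then, among all sets $V$ of $n+1$ distinct unit vectors in $\mathbf{C}^n$, $\mathrm{D}(V)$ is maximized when $w_0,\dots,w_n$ are the vertices of a real regular simplex in $\mathbf{C}^n$, and in that case $$\mathrm{D}(V) = \sqrt{\frac{(n+1)^{n-1}}{n^n}}.$$ That is, every set $V$ of $n+1$ distinct unit vectors in $\mathbf{C}^n$ satisfies $\mathrm{D}(V) \le \sqrt{(n+1)^{n-1}/n^n}$, with equality whenever $V$ is the vertex set of a real regular simplex.
   Context: Unit vectors are taken with respect to the standard Hermitian norm on $\mathbf{C}^n$, and $\det(w_{j_1},\dots,w_{j_n})$ is the determinant of the $n\times n$ matrix with columns $w_{j_1},\dots,w_{j_n}$. A regular simplex in $\mathbf{R}^n$ with vertices $p_0,\dots,p_n$ is the convex hull of $n+1$ affinely independent points all of whose pairwise distances are equal. A set $V=\{w_0,\dots,w_n\}\subset\mathbf{C}^n$ is the vertex set of a real regular simplex in $\mathbf{C}^n$ if all coordinates of all $w_j$ are real and $w_0,\dots,w_n$, viewed as points of $\mathbf{R}^n$, are the vertices of a regular simplex in $\mathbf{R}^n$. *)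

theory Defs
  imports "HOL-Analysis.Analysis"
begin

text \<open>The matrix with columns \<open>f k\<close>; \<open>A $ i $ k\<close> is the entry in row \<open>i\<close> and column \<open>k\<close>.\<close>

definition matrix_of_columns :: "('n \<Rightarrow> complex ^ 'n) \<Rightarrow> complex ^ 'n ^ 'n" where
  "matrix_of_columns f = (\<chi> i k. f k $ i)"

text \<open>
  The number \<open>D(V)\<close>. The minimum runs over all choices of \<open>n\<close> distinct vectors of \<open>V\<close>, listed in
  any order; reordering the columns only changes the sign of the determinant, so neither
  an enumeration of \<open>V\<close> nor an order on the index type is needed. The lemma
  \<open>min_abs_det_enumerated\<close> below gives the form with increasing indices.
\<close>

definition min_abs_det :: "(complex ^ 'n) set \<Rightarrow> real" where
  "min_abs_det V = Min {norm (det (matrix_of_columns f)) | f. inj f \<and> range f \<subseteq> V}"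

definition regular_simplex_vertices :: "(real ^ 'n) set \<Rightarrow> bool" where
  "regular_simplex_vertices P \<longleftrightarrow>
     card P = CARD('n) + 1 \<and> \<not> affine_dependent P \<and>
     (\<exists>d. \<forall>p\<in>P. \<forall>q\<in>P. p \<noteq> q \<longrightarrow> dist p q = d)"

definition real_regular_simplex_vertices :: "(complex ^ 'n) set \<Rightarrow> bool" where
  "real_regular_simplex_vertices V \<longleftrightarrow>
     (\<forall>w\<in>V. \<forall>i. w $ i \<in> \<real>) \<and>
     regular_simplex_vertices ((\<lambda>w. \<chi> i. Re (w $ i)) ` V)"

lemma norm_det_permute_columns:
  fixes f :: "'n::finite \<Rightarrow> complex ^ 'n"
  assumes "bij p"
  shows "norm (det (matrix_of_columns (f \<circ> p))) = norm (det (matrix_of_columns f))"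
proof -
  have p: "p permutes UNIV"
    using assms by (intro bij_imp_permutes) auto
  have "matrix_of_columns (f \<circ> p) = (\<chi> i j. matrix_of_columns f $ i $ p j)"
    by (simp add: matrix_of_columns_def vec_eq_iff)
  then have "det (matrix_of_columns (f \<circ> p)) = of_int (sign p) * det (matrix_of_columns f)"
    using det_permute_columns[OF p, of "matrix_of_columns f"] by simp
  then show ?thesis
    by (simp add: norm_mult sign_def)
qed

lemma strict_mono_into_nat_set:
  fixes S :: "nat set"
  assumes "finite S" "card S = CARD('n::{finite,linorder})"
  obtains j :: "'n::{finite,linorder} \<Rightarrow> nat" where "strict_mono j" "range j = S"
proof -
  obtain h where h: "bij_betw h {..<card S} S" "strict_mono_on {..<card S} h"
    using ex_bij_betw_strict_mono_card[OF assms(1)] by blast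
  define r :: "'n \<Rightarrow> nat" where "r x = card {y. y < x}" for x
  have r_less: "r x < card S" for x
    unfolding r_def assms(2) by (rule psubset_card_mono) auto
  have r_mono: "r x < r y" if "x < y" for x y
    unfolding r_def using that by (intro psubset_card_mono) auto
  have sm: "strict_mono (h \<circ> r)"
    using h(2) r_less r_mono by (auto simp: strict_mono_def strict_mono_on_def)
  have sub: "range (h \<circ> r) \<subseteq> S"
    using h(1) r_less by (auto simp: bij_betw_def)
  have "card (range (h \<circ> r)) = CARD('n)"
    using card_image[OF strict_mono_imp_inj_on[OF sm, of UNIV]] by simp
  then have "range (h \<circ> r) = S"
    using sub assms by (simp add: card_subset_eq)
  with sm that show ?thesis by blast
qed

lemma min_abs_det_enumerated:
  fixes w :: "nat \<Rightarrow> complex ^ ('n::{finite,linorder})"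
  assumes w: "inj_on w {0..CARD('n)}"
  shows "min_abs_det (w ` {0..CARD('n)}) =
    Min {norm (det (matrix_of_columns (\<lambda>k. w (j k)))) | j::'n \<Rightarrow> nat.
          strict_mono j \<and> range j \<subseteq> {0..CARD('n)}}"
proof -
  let ?I = "{0..CARD('n)}"
  have "\<exists>j::'n \<Rightarrow> nat. strict_mono j \<and> range j \<subseteq> ?I \<and>
      norm (det (matrix_of_columns f)) = norm (det (matrix_of_columns (\<lambda>k. w (j k))))"
    if f: "inj f" "range f \<subseteq> w ` ?I" for f
  proof -
    define g where "g k = inv_into ?I w (f k)" for k
    have fI: "f k \<in> w ` ?I" for k
      using f(2) by blast
    have wg: "w (g k) = f k" for k
      unfolding g_def by (rule f_inv_into_f[OF fI])
    have gI: "g k \<in> ?I" for k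
      unfolding g_def by (rule inv_into_into[OF fI])
    have injg: "inj g"
      using f(1) wg by (metis injI injD)
    have "card (range g) = CARD('n)"
      using injg by (simp add: card_image)
    then obtain j :: "'n \<Rightarrow> nat" where j: "strict_mono j" "range j = range g"
      using strict_mono_into_nat_set[of "range g"] by auto
    define p where "p = inv g \<circ> j"
    have gp: "g (p k) = j k" for k
      unfolding p_def using j(2) by (metis comp_apply f_inv_into_f rangeI)
    have "inj p"
      using gp strict_mono_imp_inj_on[OF j(1)] by (metis injI injD)
    then have "bij p"
      using finite_UNIV_inj_surj[OF finite] unfolding bij_def by blast
    moreover have "f \<circ> p = (\<lambda>k. w (j k))"
      using wg gp by (metis comp_apply)
    ultimately have "norm (det (matrix_of_columns f)) = norm (det (matrix_of_columns (\<lambda>k. w (j k))))"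
      using norm_det_permute_columns[of p f] by simp
    moreover have "range j \<subseteq> ?I"
      unfolding j(2) using gI by (rule image_subsetI)
    ultimately show ?thesis
      using j(1) by blast
  qed
  moreover have "inj (\<lambda>k. w (j k)) \<and> range (\<lambda>k. w (j k)) \<subseteq> w ` ?I"
    if "strict_mono j" "range j \<subseteq> ?I" for j :: "'n \<Rightarrow> nat"
    using comp_inj_on[OF strict_mono_imp_inj_on[OF that(1), of UNIV] inj_on_subset[OF w that(2)]] that(2)
    by (auto simp: comp_def)
  ultimately have "{norm (det (matrix_of_columns f)) | f. inj f \<and> range f \<subseteq> w ` ?I} =
    {norm (det (matrix_of_columns (\<lambda>k. w (j k)))) | j::'n \<Rightarrow> nat. strict_mono j \<and> range j \<subseteq> ?I}"
    by (intro Collect_cong) metis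
  then show ?thesis
    by (simp only: min_abs_det_def)
qed

end

theory Submission
  imports Defs
begin

text \<open>
  Let \<open>A\<close> have columns \<open>w\<^sub>1, \<dots>, w\<^sub>n\<close> and write \<open>w\<^sub>0 = A x\<close>. By Cramer's rule the squared moduli of
  the \<open>n + 1\<close> minors add up to \<open>|det A|\<^sup>2 (1 + |x|\<^sup>2) = det (A A\<^sup>* + w\<^sub>0 w\<^sub>0\<^sup>*)\<close>. This matrix has trace
  \<open>n + 1\<close>, so Hadamard's inequality and AM-GM bound its determinant by \<open>((n + 1) / n)\<^sup>n\<close>, and the
  smallest minor is at most the root mean square. For a regular simplex the linear dependence of the
  \<open>n + 1\<close> vertices forces all inner products to be \<open>-1/n\<close>; the Gram matrix of any \<open>n\<close> vertices
  is then a multiple of the identity plus a matrix of rank one.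
\<close>

section \<open>The Hermitian product and Hadamard's inequality\<close>

definition hprod :: "complex ^ 'n \<Rightarrow> complex ^ 'n \<Rightarrow> complex" where
  "hprod x y = (\<Sum>i\<in>UNIV. x $ i * cnj (y $ i))"

lemma hprod_self: "hprod x x = of_real ((norm x)\<^sup>2)"
  by (simp add: hprod_def norm_vec_def L2_set_def sum_nonneg complex_norm_square del: of_real_power)

lemma hprod_commute: "hprod y x = cnj (hprod x y)"
  by (simp add: hprod_def mult.commute)

lemma hprod_add_left: "hprod (x + y) z = hprod x z + hprod y z"
  by (simp add: hprod_def sum.distrib distrib_right)

lemma hprod_add_right: "hprod z (x + y) = hprod z x + hprod z y"
  by (simp add: hprod_def sum.distrib distrib_left)

lemma hprod_scale_left: "hprod (c *s x) z = c * hprod x z"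
  by (simp add: hprod_def sum_distrib_left mult.assoc)

lemma hprod_scale_right: "hprod z (c *s x) = cnj c * hprod z x"
  by (simp add: hprod_def sum_distrib_left mult_ac)

lemma hprod_sum_left: "hprod (sum f S) z = (\<Sum>j\<in>S. hprod (f j) z)"
  unfolding hprod_def sum_component sum_distrib_right by (rule sum.swap)

lemma norm_add_sq_hprod: "(norm (x + y))\<^sup>2 = (norm x)\<^sup>2 + (norm y)\<^sup>2 + 2 * Re (hprod x y)"
proof -
  have "complex_of_real ((norm (x + y))\<^sup>2) =
      of_real ((norm x)\<^sup>2) + of_real ((norm y)\<^sup>2) + (hprod x y + cnj (hprod x y))"
    unfolding hprod_self[symmetric]
    by (simp add: hprod_add_left hprod_add_right hprod_commute[of y x])
  then show ?thesis
    unfolding complex_add_cnj by (metis (no_types) of_real_add of_real_eq_iff)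
qed

text \<open>Gram-Schmidt without normalization: subtracting from a row its projections onto the rows
  already treated is a determinant-preserving row operation, and by Pythagoras it cannot lengthen
  the row. The induction enlarges the set \<open>S\<close> of treated rows.\<close>

lemma orthogonalize_rows:
  fixes A :: "complex ^ 'n ^ 'n"
  assumes "finite S"
  shows "\<exists>B. det B = det A \<and> (\<forall>i. norm (B $ i) \<le> norm (A $ i)) \<and>
    (\<forall>i\<in>S. \<forall>j\<in>S. i \<noteq> j \<longrightarrow> hprod (B $ i) (B $ j) = 0)"
  using assms
proof (induction S rule: finite_induct)
  case empty
  show ?case by auto
next
  case (insert k S)
  then obtain B where B: "det B = det A" "\<And>i. norm (B $ i) \<le> norm (A $ i)"
    "\<And>i j. i \<in> S \<Longrightarrow> j \<in> S \<Longrightarrow> i \<noteq> j \<Longrightarrow> hprod (B $ i) (B $ j) = 0"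
    by blast
  \<comment> \<open>Projection coefficients. If \<open>B $ j = 0\<close>, the quotient defaults to
    0, which is harmless because the numerator vanishes as well.\<close>
  define c where "c j = hprod (B $ k) (B $ j) / hprod (B $ j) (B $ j)" for j
  define x where "x = (\<Sum>j\<in>S. (- c j) *s B $ j)"
  define C where "C = (\<chi> i. if i = k then row k B + x else row i B)"
  have rowB: "row i B = B $ i" for i
    by (simp add: row_def vec_eq_iff)
  have "x \<in> vec.span {row j B |j. j \<noteq> k}"
    unfolding x_def using insert.hyps
    by (intro vec.span_sum vec.span_scale vec.span_base) (auto simp: rowB)
  from det_row_span[OF this] have det: "det C = det A"
    by (simp only: C_def B(1))
  have Ck: "C $ k = B $ k + x" and Ci: "\<And>i. i \<noteq> k \<Longrightarrow> C $ i = B $ i"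
    by (auto simp: C_def rowB)
  have orth: "hprod (C $ k) (B $ i) = 0" if "i \<in> S" for i
  proof -
    have "hprod x (B $ i) = (\<Sum>j\<in>S. if j = i then - c i * hprod (B $ i) (B $ i) else 0)"
      unfolding x_def hprod_sum_left hprod_scale_left
      using B(3) that by (intro sum.cong) auto
    also have "\<dots> = - c i * hprod (B $ i) (B $ i)"
      using that insert.hyps by simp
    also have "\<dots> = - hprod (B $ k) (B $ i)"
      by (cases "B $ i = 0") (simp_all add: c_def hprod_self, simp add: hprod_def)
    finally show ?thesis by (simp add: Ck hprod_add_left)
  qed
  \<comment> \<open>\<open>x\<close> is a combination of rows orthogonal to \<open>C $ k\<close>, so
    \<open>B $ k = C $ k + (- x)\<close> is an orthogonal decomposition.\<close>
  have "hprod (C $ k) (- x) = 0"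
  proof -
    have "hprod (- x) (C $ k) = (\<Sum>j\<in>S. c j * hprod (B $ j) (C $ k))"
      unfolding x_def sum_negf[symmetric]
      by (simp add: hprod_sum_left hprod_scale_left[symmetric])
    also have "\<dots> = 0"
      using orth by (intro sum.neutral) (simp add: hprod_commute[of "C $ k"])
    finally show ?thesis
      using hprod_commute[of "- x"] by simp
  qed
  then have "(norm (B $ k))\<^sup>2 = (norm (C $ k))\<^sup>2 + (norm x)\<^sup>2"
    using norm_add_sq_hprod[of "C $ k" "- x"] by (simp add: Ck)
  then have "norm (C $ k) \<le> norm (B $ k)"
    using power2_le_imp_le[of "norm (C $ k)" "norm (B $ k)"] by simp
  then have "norm (C $ i) \<le> norm (A $ i)" for i
    using B(2)[of i] Ci[of i] by (cases "i = k") auto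
  moreover have "hprod (C $ i) (C $ j) = 0"
    if "i \<in> insert k S" "j \<in> insert k S" "i \<noteq> j" for i j
  proof -
    consider "i = k" "j \<in> S" "j \<noteq> k" | "j = k" "i \<in> S" "i \<noteq> k" | "i \<in> S" "j \<in> S" "i \<noteq> k" "j \<noteq> k"
      using \<open>i \<in> insert k S\<close> \<open>j \<in> insert k S\<close> \<open>i \<noteq> j\<close> by auto
    then show ?thesis
    proof cases
      case 1
      then show ?thesis using orth Ci by simp
    next
      case 2
      then show ?thesis using orth[of i] Ci hprod_commute[of "C $ i" "C $ k"]
        by (simp add: hprod_commute[of "B $ i"])
    next
      case 3
      then show ?thesis using B(3) Ci \<open>i \<noteq> j\<close> by simp
    qed
  qed
  ultimately show ?case
    using det by blast
qed

definition adjoint_matrix :: "complex ^ 'n ^ 'm \<Rightarrow> complex ^ 'm ^ 'n" where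
  "adjoint_matrix A = (\<chi> i j. cnj (A $ j $ i))"

lemma det_adjoint_matrix: "det (adjoint_matrix A) = cnj (det A)"
proof -
  have "det (adjoint_matrix A) = det (transpose (adjoint_matrix A))"
    by simp
  also have "\<dots> = cnj (det A)"
    by (simp add: det_def transpose_def adjoint_matrix_def)
  finally show ?thesis .
qed

text \<open>The Gram matrix of the rows factors as \<open>A\<close> times its adjoint.\<close>

lemma det_hprod_rows:
  "det (\<chi> i j. hprod (A $ i) (A $ j)) = of_real ((norm (det A))\<^sup>2)"
proof -
  have "(\<chi> i j. hprod (A $ i) (A $ j)) = A ** adjoint_matrix A"
    by (simp add: matrix_matrix_mult_def adjoint_matrix_def hprod_def vec_eq_iff)
  then show ?thesis
    by (simp add: det_mul det_adjoint_matrix complex_norm_square del: of_real_power)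
qed

text \<open>Orthogonalizing makes the Gram matrix of the rows diagonal, so
  \<open>norm (det A)\<close> is the product of the new row norms, none of which has grown.\<close>

lemma hadamard_inequality:
  fixes A :: "complex ^ 'n ^ 'n"
  shows "norm (det A) \<le> (\<Prod>i\<in>UNIV. norm (A $ i))"
proof -
  obtain B where B: "det B = det A" "\<And>i. norm (B $ i) \<le> norm (A $ i)"
    "\<And>i j. i \<noteq> j \<Longrightarrow> hprod (B $ i) (B $ j) = 0"
    using orthogonalize_rows[of UNIV A] by auto
  have "det (\<chi> i j. hprod (B $ i) (B $ j)) = (\<Prod>i\<in>UNIV. of_real ((norm (B $ i))\<^sup>2))"
    using B(3) by (subst det_diagonal) (auto simp: hprod_self)
  then have "complex_of_real ((norm (det B))\<^sup>2) = of_real ((\<Prod>i\<in>UNIV. norm (B $ i))\<^sup>2)"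
    by (simp add: det_hprod_rows prod_power_distrib)
  then have "(norm (det B))\<^sup>2 = (\<Prod>i\<in>UNIV. norm (B $ i))\<^sup>2"
    by (simp only: of_real_eq_iff)
  then have "norm (det B) = (\<Prod>i\<in>UNIV. norm (B $ i))"
    by (simp add: prod_nonneg)
  also have "\<dots> \<le> (\<Prod>i\<in>UNIV. norm (A $ i))"
    by (intro prod_mono) (simp add: B)
  finally show ?thesis by (simp add: B)
qed

lemma norm_det_sq_le_mean_power:
  fixes A :: "complex ^ 'n ^ 'n"
  shows "(norm (det A))\<^sup>2 \<le> ((\<Sum>i\<in>UNIV. (norm (A $ i))\<^sup>2) / real CARD('n)) ^ CARD('n)"
proof -
  let ?p = "\<Prod>i\<in>UNIV. (norm (A $ i))\<^sup>2"
  have "(norm (det A))\<^sup>2 \<le> (\<Prod>i\<in>UNIV. norm (A $ i))\<^sup>2"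
    by (intro power_mono hadamard_inequality) simp
  also have "\<dots> = ?p"
    by (simp add: prod_power_distrib)
  also have "\<dots> = (root CARD('n) ?p) ^ CARD('n)"
    by (simp add: prod_nonneg)
  also have "\<dots> \<le> ((\<Sum>i\<in>UNIV. (norm (A $ i))\<^sup>2) / real CARD('n)) ^ CARD('n)"
    using arith_geom_mean[of "UNIV :: 'n set" "\<lambda>i. (norm (A $ i))\<^sup>2"]
    by (intro power_mono) (auto simp: prod_nonneg root_powr_inverse sum_divide_distrib)
  finally show ?thesis .
qed

section \<open>Determinant of the identity plus a rank-one matrix\<close>

lemma det_axis_rows_except_one:
  fixes v :: "'a::field ^ 'n"
  shows "det (\<chi> i. if i = k then v else axis i 1) = v $ k"
proof -
  \<comment> \<open>Over the identity matrix, \<open>v\<close> is the combination of the rows with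
    its own entries as coefficients, so Cramer's rule yields the entry \<open>v $ k\<close>.\<close>
  have "(\<Sum>i\<in>UNIV. v $ i *s row i (mat 1 :: 'a ^ 'n ^ 'n)) = v"
    by (simp add: vec_eq_iff row_def mat_def if_distrib cong: if_cong)
  moreover have "row i (mat 1 :: 'a ^ 'n ^ 'n) = axis i 1" for i
    by (auto simp: vec_eq_iff row_def mat_def axis_def)
  ultimately show ?thesis
    using cramer_lemma_transpose[of k v "mat 1"] by (simp only: det_I mult_1_right)
qed

text \<open>Row \<open>k\<close> equals \<open>v\<close>, so the terms \<open>u i *s v\<close> in
  the other rows are multiples of row \<open>k\<close> and row operations remove them.\<close>

lemma det_axis_plus_multiple_rows_except_one:
  fixes v :: "'a::field ^ 'n"
  assumes "finite S" "k \<notin> S"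
  shows "det (\<chi> i. if i = k then v else if i \<in> S then axis i 1 + u i *s v else axis i 1) = v $ k"
  using assms
proof (induction S rule: finite_induct)
  case empty
  show ?case using det_axis_rows_except_one[of k v] by (simp cong: if_cong)
next
  case (insert j S)
  let ?A = "\<lambda>T. \<chi> i. if i = k then v else if i \<in> T then axis i 1 + u i *s v else axis i 1"
  have "?A (insert j S) = (\<chi> i. if i = j then row j (?A S) + u j *s row k (?A S) else row i (?A S))"
    using insert by (auto simp: vec_eq_iff row_def)
  then have "det (?A (insert j S)) = det (?A S)"
    using insert det_row_operation[of j k "?A S" "u j"] by auto
  then show ?case
    using insert by simp
qed

text \<open>The rank-one term is added one row at a time. Linearity in row \<open>k\<close> splits
  off \<open>u k\<close> times a determinant whose row \<open>k\<close> is \<open>v\<close>; by the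
  preceding lemma this contributes \<open>u k * v $ k\<close>.\<close>

lemma det_identity_plus_rank_one:
  fixes v :: "'a::field ^ 'n"
  shows "det (\<chi> i j. (if i = j then 1 else 0) + u i * v $ j) = 1 + (\<Sum>i\<in>UNIV. u i * v $ i)"
proof -
  have "det (\<chi> i. if i \<in> S then axis i 1 + u i *s v else axis i 1) = 1 + (\<Sum>i\<in>S. u i * v $ i)"
    if "finite S" for S
    using that
  proof (induction S rule: finite_induct)
    case empty
    have "(\<chi> i. axis i 1) = (mat 1 :: 'a ^ 'n ^ 'n)"
      by (auto simp: vec_eq_iff mat_def axis_def)
    then show ?case by simp
  next
    case (insert k S)
    let ?r = "\<lambda>i. if i \<in> S then axis i 1 + u i *s v else axis i 1"
    have "det (\<chi> i. if i \<in> insert k S then axis i 1 + u i *s v else axis i 1) =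
        det (\<chi> i. if i = k then axis i 1 + u i *s v else ?r i)"
      by (rule arg_cong[of _ _ det]) (auto simp: vec_eq_iff)
    also have "\<dots> = det (\<chi> i. if i = k then axis i 1 else ?r i)
        + u k * det (\<chi> i. if i = k then v else ?r i)"
      using det_row_add[of k "\<lambda>i. axis i 1" "\<lambda>i. u i *s v" ?r]
        det_row_mul[of k "u k" "\<lambda>_. v" ?r] by (simp cong: if_cong)
    also have "(\<chi> i. if i = k then axis i 1 else ?r i) = (\<chi> i. ?r i)"
      using insert by (auto simp: vec_eq_iff)
    finally show ?case
      using insert det_axis_plus_multiple_rows_except_one[of S k v u] by simp
  qed
  from this[of UNIV] show ?thesis
    by (simp add: axis_def vector_scalar_mult_def plus_vec_def eq_commute cong: if_cong)
qed


section \<open>Real vectors, Frobenius norms and appending a column\<close>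

lemma hprod_of_real:
  assumes "\<And>i. x $ i \<in> \<real>" "\<And>i. y $ i \<in> \<real>"
  shows "hprod x y = of_real ((\<chi> i. Re (x $ i)) \<bullet> (\<chi> i. Re (y $ i)))"
  using assms by (simp add: hprod_def inner_vec_def complex_is_Real_iff complex_eq_iff)

lemma sum_norm_sq_rows:
  "(\<Sum>i\<in>UNIV. (norm (A $ i))\<^sup>2) = (\<Sum>i\<in>UNIV. \<Sum>j\<in>UNIV. (norm (A $ i $ j))\<^sup>2)"
  by (simp add: norm_vec_def L2_set_def sum_nonneg)

text \<open>Hadamard's inequality is applied to rows, whereas the unit vectors are columns; the
  squared Frobenius norm can be summed either way.\<close>

lemma sum_norm_sq_matrix_of_columns:
  "(\<Sum>i\<in>UNIV. (norm (matrix_of_columns f $ i))\<^sup>2) = (\<Sum>k\<in>UNIV. (norm (f k))\<^sup>2)"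
proof -
  have "(\<Sum>k\<in>UNIV. (norm (f k))\<^sup>2) = (\<Sum>k\<in>UNIV. \<Sum>i\<in>UNIV. (norm (f k $ i))\<^sup>2)"
    by (simp add: norm_vec_def L2_set_def sum_nonneg)
  also have "\<dots> = (\<Sum>i\<in>UNIV. \<Sum>k\<in>UNIV. (norm (f k $ i))\<^sup>2)"
    by (rule sum.swap)
  finally show ?thesis
    unfolding sum_norm_sq_rows by (simp add: matrix_of_columns_def)
qed

text \<open>
  The matrix \<open>R = I + s x x\<^sup>*\<close> is the positive square root of \<open>I + x x\<^sup>*\<close>, so that \<open>A R\<close> plays
  the role of the non-square matrix obtained from \<open>A\<close> by appending the column \<open>A x\<close>.
\<close>

lemma norm_det_sq_append_column_le:
  fixes A :: "complex ^ 'n ^ 'n"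
  shows "(norm (det A))\<^sup>2 * (1 + (norm x)\<^sup>2)
    \<le> (((\<Sum>i\<in>UNIV. (norm (A $ i))\<^sup>2) + (norm (A *v x))\<^sup>2) / real CARD('n)) ^ CARD('n)"
proof -
  define q where "q = sqrt (1 + (norm x)\<^sup>2)"
  \<comment> \<open>Squaring \<open>R\<close> gives the condition
    \<open>2 * s + s\<^sup>2 * (norm x)\<^sup>2 = 1\<close>. Its root
    \<open>(q - 1) / (norm x)\<^sup>2\<close> is written as \<open>1 / (1 + q)\<close>, which also
    covers \<open>x = 0\<close>.\<close>
  define s where "s = 1 / (1 + q)"
  have q: "q > 0" "q\<^sup>2 = 1 + (norm x)\<^sup>2"
    by (auto simp: q_def intro!: add_pos_nonneg)
  then have m: "(norm x)\<^sup>2 = (q - 1) * (q + 1)"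
    by (simp add: power2_eq_square algebra_simps)
  have sm: "s * (norm x)\<^sup>2 = q - 1"
    unfolding m s_def using q(1) by (simp add: field_simps)
  have s: "2 * s + s * (s * (norm x)\<^sup>2) = 1"
    unfolding sm using q(1) by (simp add: s_def add_divide_distrib[symmetric])
  \<comment> \<open>The conjugate entries of \<open>y\<close> make the rank-one term
    \<open>s x x\<^sup>*\<close>, and they turn \<open>hprod (A $ i) y\<close> into the entry
    \<open>(A *v x) $ i\<close>.\<close>
  define y :: "complex ^ 'n" where "y = (\<chi> j. cnj (x $ j))"
  define R where "R = (\<chi> i j. (if i = j then 1 else 0) + (of_real s * x $ i) * y $ j)"
  have "det R = 1 + of_real s * hprod x x"
    unfolding R_def det_identity_plus_rank_one
    by (simp add: y_def hprod_def sum_distrib_left mult.assoc)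
  also have "\<dots> = of_real (1 + s * (norm x)\<^sup>2)"
    by (simp add: hprod_self)
  finally have detR: "det R = of_real q"
    by (simp add: sm)
  have ny: "norm y = norm x"
    by (simp add: y_def norm_vec_def)
  \<comment> \<open>Row \<open>i\<close> of \<open>A ** R\<close> is as long as row \<open>i\<close>
    of \<open>A\<close> with the entry \<open>(A *v x) $ i\<close> appended: the cross term and the
    square of the correction contribute the two summands of the condition on
    \<open>s\<close>.\<close>
  have row: "(norm ((A ** R) $ i))\<^sup>2 = (norm (A $ i))\<^sup>2 + (norm ((A *v x) $ i))\<^sup>2" for i
  proof -
    let ?b = "(A *v x) $ i"
    have r: "(A ** R) $ i = A $ i + (of_real s * ?b) *s y"
      by (simp add: vec_eq_iff matrix_matrix_mult_def R_def matrix_vector_mult_def distrib_left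
          sum.distrib sum_distrib_left sum_distrib_right mult_ac
          if_distrib[of "\<lambda>z. _ * z"] cong: if_cong)
    have h: "hprod (A $ i) y = ?b"
      by (simp add: hprod_def y_def matrix_vector_mult_def)
    have "hprod (A $ i) ((of_real s * ?b) *s y) = of_real (s * (norm ?b)\<^sup>2)"
      by (simp add: hprod_scale_right h complex_norm_square mult_ac del: of_real_power)
    moreover have "(norm ((of_real s * ?b) *s y))\<^sup>2 = s * (s * (norm x)\<^sup>2) * (norm ?b)\<^sup>2"
    proof -
      have "norm (c *s y) = norm c * norm y" for c :: complex
        by (simp add: norm_vec_def L2_set_right_distrib norm_mult)
      then show ?thesis
        by (simp add: norm_mult ny power_mult_distrib power2_eq_square)
    qed
    ultimately have "(norm ((A ** R) $ i))\<^sup>2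
        = (norm (A $ i))\<^sup>2 + (2 * s + s * (s * (norm x)\<^sup>2)) * (norm ?b)\<^sup>2"
      unfolding r norm_add_sq_hprod by (simp add: algebra_simps)
    then show ?thesis
      unfolding s by simp
  qed
  have "(norm (det A))\<^sup>2 * (1 + (norm x)\<^sup>2) = (norm (det (A ** R)))\<^sup>2"
    using q by (simp add: det_mul detR norm_mult power_mult_distrib)
  also have "\<dots> \<le> ((\<Sum>i\<in>UNIV. (norm ((A ** R) $ i))\<^sup>2) / real CARD('n)) ^ CARD('n)"
    by (rule norm_det_sq_le_mean_power)
  also have "(\<Sum>i\<in>UNIV. (norm ((A ** R) $ i))\<^sup>2)
      = (\<Sum>i\<in>UNIV. (norm (A $ i))\<^sup>2) + (norm (A *v x))\<^sup>2"
    unfolding row by (simp add: sum.distrib norm_vec_def[of "A *v x"] L2_set_def sum_nonneg)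
  finally show ?thesis .
qed

section \<open>Inner products and minors of a regular simplex\<close>

text \<open>Equal distances between unit vectors give a common inner product \<open>g\<close>. More
  points than the dimension are linearly dependent; pairing the dependence with each point shows
  that all its coefficients agree, and then \<open>1 + n * g = 0\<close>.\<close>

lemma inner_regular_simplex_vertices:
  fixes P :: "(real ^ 'n) set"
  assumes card: "card P = CARD('n) + 1"
    and unit: "\<And>p. p \<in> P \<Longrightarrow> norm p = 1"
    and dist: "\<And>p q. p \<in> P \<Longrightarrow> q \<in> P \<Longrightarrow> p \<noteq> q \<Longrightarrow> dist p q = d"
    and pq: "p \<in> P" "q \<in> P" "p \<noteq> q"
  shows "p \<bullet> q = - 1 / real CARD('n)"
proof -
  define g where "g = 1 - d\<^sup>2 / 2"
  have fin: "finite P"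
    using card by (intro card_ge_0_finite) simp
  have inner: "a \<bullet> b = g" if "a \<in> P" "b \<in> P" "a \<noteq> b" for a b
    using dist[OF that] unit[OF that(1)] unit[OF that(2)]
    by (simp add: g_def dist_norm dot_norm_neg)
  have self: "a \<bullet> a = 1" if "a \<in> P" for a
    using unit[OF that] by (simp add: norm_eq_1)
  \<comment> \<open>Distinct points have \<open>d \<noteq> 0\<close>; this later allows cancelling
    \<open>1 - g\<close>.\<close>
  have "g \<noteq> 1"
    using dist[OF pq] pq by (auto simp: g_def)
  have "dependent P"
    using fin card by (intro dependent_biggerset) auto
  then obtain u v where u: "v \<in> P" "u v \<noteq> 0" "(\<Sum>p\<in>P. u p *\<^sub>R p) = 0"
    using dependent_finite[OF fin] by auto
  let ?C = "sum u P"
  have eq: "(1 - g) * u a = - g * ?C" if "a \<in> P" for a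
  proof -
    have "0 = a \<bullet> (\<Sum>p\<in>P. u p *\<^sub>R p)"
      by (simp add: u)
    also have "\<dots> = (\<Sum>p\<in>P. u p * (a \<bullet> p))"
      by (simp add: inner_sum_right)
    also have "\<dots> = (\<Sum>p\<in>P. g * u p + (if p = a then (1 - g) * u a else 0))"
      using that inner self by (intro sum.cong) (auto simp: algebra_simps)
    also have "\<dots> = g * ?C + (1 - g) * u a"
      using fin that by (simp add: sum.distrib sum_distrib_left)
    finally show ?thesis by simp
  qed
  have "u a = u v" if "a \<in> P" for a
    using eq[OF that] eq[OF u(1)] \<open>g \<noteq> 1\<close> by (metis eq_iff_diff_eq_0 mult_cancel_left)
  then have "?C = (real CARD('n) + 1) * u v"
    by (simp add: card)
  with eq[OF u(1)] have "(1 - g) * u v = (- g * (real CARD('n) + 1)) * u v"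
    by simp
  then have "1 - g = - g * (real CARD('n) + 1)"
    using u(2) by (simp only: mult_cancel_right) simp
  then have "g = - 1 / real CARD('n)"
    by (simp add: field_simps)
  then show ?thesis
    using inner pq by simp
qed

text \<open>The Gram matrix of the rows is \<open>r\<close> times \<open>M\<close>, where
  \<open>M\<close> is the identity minus the all-ones matrix divided by \<open>n + 1\<close>. Hence
  its determinant is \<open>r ^ n / (n + 1)\<close>.\<close>

lemma norm_det_sq_of_inner:
  fixes A :: "complex ^ 'n ^ 'n"
  assumes unit: "\<And>i. norm (A $ i) = 1"
    and inner: "\<And>i j. i \<noteq> j \<Longrightarrow> hprod (A $ i) (A $ j) = of_real (- 1 / real CARD('n))"
  shows "(norm (det A))\<^sup>2 = (real CARD('n) + 1) ^ (CARD('n) - 1) / real CARD('n) ^ CARD('n)"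
proof -
  let ?n = "real CARD('n)"
  define r where "r = (?n + 1) / ?n"
  define M :: "complex ^ 'n ^ 'n"
    where "M = (\<chi> i j. (if i = j then 1 else 0) + of_real (- 1 / (?n + 1)) * (1 :: complex ^ 'n) $ j)"
  have "hprod (A $ i) (A $ j) = of_real r * M $ i $ j" for i j
  proof (cases "i = j")
    case True
    have "r * (1 + - 1 / (?n + 1)) = 1"
      unfolding r_def by (simp add: divide_simps add_eq_0_iff)
    then have "complex_of_real r * (1 + of_real (- 1 / (?n + 1))) = 1"
      by (metis of_real_1 of_real_add of_real_mult)
    then show ?thesis
      using True unfolding M_def by (simp add: hprod_self unit)
  next
    case False
    have "r * (- 1 / (?n + 1)) = - 1 / ?n"
      by (simp add: r_def)
    then have "complex_of_real r * of_real (- 1 / (?n + 1)) = of_real (- 1 / ?n)"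
      by (metis of_real_mult)
    then show ?thesis
      using False inner[OF False] unfolding M_def by simp
  qed
  then have "of_real ((norm (det A))\<^sup>2) = det (\<chi> i. of_real r *s M $ i)"
    unfolding det_hprod_rows[symmetric]
    by (intro arg_cong[of _ _ det]) (simp add: vec_eq_iff)
  also have "\<dots> = of_real r ^ CARD('n) * det M"
    by (simp add: det_rows_mul)
  also have "det M = of_real (1 - ?n / (?n + 1))"
    unfolding M_def det_identity_plus_rank_one by simp
  finally have "complex_of_real ((norm (det A))\<^sup>2) = of_real (r ^ CARD('n) * (1 - ?n / (?n + 1)))"
    by simp
  then have "(norm (det A))\<^sup>2 = r ^ CARD('n) * (1 - ?n / (?n + 1))"
    by (simp only: of_real_eq_iff)
  also have "1 - ?n / (?n + 1) = 1 / (?n + 1)"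
    by (simp add: field_simps)
  also have "r ^ CARD('n) * (1 / (?n + 1)) = (?n + 1) ^ (CARD('n) - 1) / ?n ^ CARD('n)"
    by (cases "CARD('n)") (simp_all add: r_def power_divide)
  finally show ?thesis .
qed

section \<open>The upper bound and the equality case\<close>

theorem theorem13:
  fixes V :: "(complex ^ 'n) set"
  assumes "card V = CARD('n) + 1"
    and "\<forall>w\<in>V. norm w = 1"
  shows "min_abs_det V \<le> sqrt ((real CARD('n) + 1) ^ (CARD('n) - 1) / real CARD('n) ^ CARD('n)) \<and>
    (real_regular_simplex_vertices V \<longrightarrow>
      min_abs_det V = sqrt ((real CARD('n) + 1) ^ (CARD('n) - 1) / real CARD('n) ^ CARD('n)))"
proof -
  let ?n = "real CARD('n)"
  define bound where "bound = (?n + 1) ^ (CARD('n) - 1) / ?n ^ CARD('n)"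
  define T where "T = {f :: 'n \<Rightarrow> complex ^ 'n. inj f \<and> range f \<subseteq> V}"
  define \<delta> where "\<delta> f = norm (det (matrix_of_columns f))" for f :: "'n \<Rightarrow> complex ^ 'n"
  have D: "min_abs_det V = Min (\<delta> ` T)"
    unfolding min_abs_det_def T_def \<delta>_def by (rule arg_cong[of _ _ Min]) blast
  have finV: "finite V"
    using assms(1) by (intro card_ge_0_finite) simp
  have "T \<subseteq> PiE UNIV (\<lambda>_. V)"
    unfolding T_def by auto
  then have finT: "finite T"
    by (rule finite_subset) (simp add: finite_PiE finV)
  \<comment> \<open>\<open>w\<close> plays the role of \<open>w\<^sub>0\<close> and \<open>f\<close>
    enumerates the remaining vectors; \<open>f\<close> also shows that the minimum runs over a
    nonempty set.\<close>
  obtain w where w: "w \<in> V"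
    using assms(1) by fastforce
  have "card (V - {w}) = CARD('n)"
    using assms(1) w finV by simp
  then obtain f :: "'n \<Rightarrow> complex ^ 'n" where f: "bij_betw f UNIV (V - {w})"
    using finite_same_card_bij[of "UNIV :: 'n set" "V - {w}"] finV by auto
  have injf: "inj f" and rf: "range f = V - {w}"
    using f by (auto simp: bij_betw_def)
  have fT: "f \<in> T"
    using injf rf by (auto simp: T_def)
  have Dle: "min_abs_det V \<le> \<delta> g" if "g \<in> T" for g
    unfolding D using finT that by simp
  have D0: "0 \<le> min_abs_det V"
    unfolding D using finT fT by (subst Min_ge_iff) (auto simp: \<delta>_def)
  let ?D = "min_abs_det V"
  have "?D\<^sup>2 \<le> bound"
  \<comment> \<open>One vanishing minor already makes the minimum 0; otherwise \<open>w\<close> can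
    be expressed in the columns.\<close>
  proof (cases "det (matrix_of_columns f) = 0")
    case True
    then have "?D = 0"
      using Dle[OF fT] D0 by (simp add: \<delta>_def)
    then show ?thesis
      by (simp add: bound_def)
  next
    case False
    let ?A = "matrix_of_columns f"
    have "surj ((*v) ?A)"
      using False invertible_det_nz[of ?A] invertible_eq_bij[of ?A] by (simp add: bij_def)
    then obtain x where x: "?A *v x = w"
      by (metis surjD)
    \<comment> \<open>Cramer's rule for the minor in which \<open>w\<close> replaces column
      \<open>k\<close>; the new family stays injective because \<open>w\<close> is outside the range
      of \<open>f\<close>.\<close>
    have minor: "?D \<le> norm (x $ k) * norm (det ?A)" for k
    proof -
      have "matrix_of_columns (f(k := w)) = (\<chi> i j. if j = k then (?A *v x) $ i else ?A $ i $ j)"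
        by (simp add: matrix_of_columns_def vec_eq_iff x[unfolded matrix_of_columns_def])
      then have "\<delta> (f(k := w)) = norm (x $ k) * norm (det ?A)"
        by (simp add: \<delta>_def cramer_lemma norm_mult)
      moreover have "f(k := w) \<in> T"
        using injf rf w by (auto simp: T_def inj_def)
      ultimately show ?thesis
        using Dle by metis
    qed
    \<comment> \<open>Each of the \<open>n + 1\<close> squared minors is at least
      \<open>?D\<^sup>2\<close>, so their sum is compared with
      \<open>(n + 1) * ?D\<^sup>2\<close>.\<close>
    have "(?n + 1) * ?D\<^sup>2 = ?D\<^sup>2 + (\<Sum>k\<in>(UNIV :: 'n set). ?D\<^sup>2)"
      by (simp add: algebra_simps)
    also have "\<dots> \<le> (norm (det ?A))\<^sup>2 + (\<Sum>k\<in>UNIV. (norm (x $ k) * norm (det ?A))\<^sup>2)"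
      using Dle[OF fT] D0 minor by (intro add_mono sum_mono power_mono) (auto simp: \<delta>_def)
    also have "\<dots> = (norm (det ?A))\<^sup>2 * (1 + (norm x)\<^sup>2)"
      by (simp add: norm_vec_def[of x] L2_set_def sum_nonneg
          sum_distrib_left algebra_simps)
    also have "\<dots> \<le> (((\<Sum>i\<in>UNIV. (norm (?A $ i))\<^sup>2) + (norm (?A *v x))\<^sup>2) / ?n) ^ CARD('n)"
      by (rule norm_det_sq_append_column_le)
    also have "(\<Sum>i\<in>UNIV. (norm (?A $ i))\<^sup>2) = ?n"
    proof -
      have "norm (f k) = 1" for k
        using rf assms(2) by auto
      then show ?thesis
        by (simp add: sum_norm_sq_matrix_of_columns)
    qed
    also have "norm (?A *v x) = 1"
      using x w assms(2) by simp
    also have "((?n + 1\<^sup>2) / ?n) ^ CARD('n) = (?n + 1) * bound"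
      unfolding bound_def by (cases "CARD('n)") (simp_all add: power_divide)
    finally show ?thesis
      by simp
  qed
  then have upper: "?D \<le> sqrt bound"
    by (rule real_le_rsqrt)
  have "?D = sqrt bound" if V: "real_regular_simplex_vertices V"
  proof -
    define re :: "complex ^ 'n \<Rightarrow> real ^ 'n" where "re = (\<lambda>w. \<chi> i. Re (w $ i))"
    have real: "v $ i \<in> \<real>" if "v \<in> V" for v i
      using V that by (auto simp: real_regular_simplex_vertices_def)
    have simplex: "regular_simplex_vertices (re ` V)"
      using V by (simp only: real_regular_simplex_vertices_def re_def)
    then obtain d where d: "\<forall>p\<in>re ` V. \<forall>q\<in>re ` V. p \<noteq> q \<longrightarrow> dist p q = d"
      unfolding regular_simplex_vertices_def by meson
    have card_re: "card (re ` V) = CARD('n) + 1"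
      using simplex by (simp only: regular_simplex_vertices_def)
    \<comment> \<open>The image keeps the cardinality of \<open>V\<close>, so distinct columns
      remain distinct real points.\<close>
    have inj: "inj_on re V"
      using card_re assms(1) finV by (intro eq_card_imp_inj_on) auto
    have inner_re: "hprod u v = of_real (re u \<bullet> re v)" if "u \<in> V" "v \<in> V" for u v
      unfolding re_def using real that by (intro hprod_of_real)
    have unit: "norm p = 1" if p: "p \<in> re ` V" for p
    proof -
      obtain v where v: "v \<in> V" "p = re v"
        using p by blast
      have "complex_of_real ((norm v)\<^sup>2) = of_real ((norm p)\<^sup>2)"
        using inner_re[OF v(1) v(1)] v(2)
        by (simp only: hprod_self power2_norm_eq_inner[of "re v"])
      then have "(norm v)\<^sup>2 = (norm p)\<^sup>2"
        by (simp only: of_real_eq_iff)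
      then have "norm p = norm v"
        by simp
      then show ?thesis
        using assms(2) v(1) by simp
    qed
    have "\<delta> g = sqrt bound" if g: "g \<in> T" for g
    proof -
      have gV: "g k \<in> V" for k
        using g by (auto simp: T_def)
      \<comment> \<open>Transposing turns the chosen vertices into rows, to which the Gram
        computation applies. All minors then have the same modulus, so the minimum is that
        value.\<close>
      let ?B = "transpose (matrix_of_columns g)"
      have row: "?B $ k = g k" for k
        by (simp add: transpose_def matrix_of_columns_def vec_eq_iff)
      have "hprod (?B $ i) (?B $ j) = of_real (- 1 / ?n)" if "i \<noteq> j" for i j
      proof -
        have "g i \<noteq> g j"
          using g that by (auto simp: T_def inj_def)
        then have "re (g i) \<noteq> re (g j)"
          using inj gV by (meson inj_onD)
        then have "re (g i) \<bullet> re (g j) = - 1 / ?n"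
          using d gV by (intro inner_regular_simplex_vertices[OF card_re unit]) blast+
        then show ?thesis
          unfolding row using gV by (simp only: inner_re)
      qed
      moreover have "norm (?B $ i) = 1" for i
        unfolding row using gV assms(2) by blast
      ultimately have "(norm (det ?B))\<^sup>2 = bound"
        unfolding bound_def by (intro norm_det_sq_of_inner)
      then show ?thesis
        by (simp add: \<delta>_def real_sqrt_unique)
    qed
    then have "\<delta> ` T = {sqrt bound}"
      using fT by auto
    then show ?thesis
      by (simp add: D)
  qed
  with upper show ?thesis
    unfolding bound_def by blast
qed

end
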